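(* Let $(M,\mathcal B,\mu,\Phi_t)$ be a dynamical system with pure point spectrum and smooth generating Koopman eigenfunctions $\zeta_1,\dots,\zeta_m$ as described in the context, with dynamical vector field $v$, and let $\pi_i=\zeta_i : M\to S^1\subset\mathbb C$, $i\in\{1,\dots,m\}$. Then $v$ is projectible under $\pi_i$, in the following sense: for any $a,b\in M$ such that $\pi_i(a)=\pi_i(b)$, the equality $$\pi_{i*}(v|_a)=\pi_{i*}(v|_b)$$ holds in $T_{\pi_i(a)}\mathbb C=T_{\pi_i(b)}\mathbb C$, where $\pi_{i*}:TM\to T\mathbb C$ is the derivative map of $\pi_i$.
   Context: Setting. $M$ is a closed, connected, compact, orientable $C^\infty$ manifold of dimension $m$ with Borel $\sigma$-algebra $\mathcal B$; $\Phi_t:M\to M$, $t\in\mathbb R$, is a smooth flow with generating smooth vector field $v$, $v(f)=\lim_{t\to0}(f\circ\Phi_t-f)/t$; $\mu$ is a $\Phi_t$-invariant Borel probability measure with smooth positive density in local coordinates. For a fixed sampling interval $T>0$ the discrete-time system $\hat\Phi_n=\Phi_{nT}$, $n\in\mathbb Z$, is ergodic for $\mu$. $U_tf=f\circ\Phi_t$ is the unitary Koopman group on $L^2(M,\mu)$ and $\tilde v$ its skew-adjoint generator, which extends $v$ from $C^\infty(M)$. Pure point spectrum. There are rationally independent real numbers $\Omega_1,\dots,\Omega_m$ (basic frequencies; $\sum_i k_i\Omega_i=0$ with $k_i\in\mathbb Z$ only if all $k_i=0$) and eigenfunctions $\zeta_i$ of $\tilde v$ with $\tilde v(\zeta_i)=\mathrm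 i\,\Omega_i\zeta_i$ such that the functions $z_k=\prod_{i=1}^m\zeta_i^{k_i}$, $k=(k_1,\dots,k_m)\in\mathbb Z^m$, which are eigenfunctions at eigenvalue $\mathrm i\sum_i k_i\Omega_i$, form an orthonormal basis of $L^2(M,\mu)$. The $\zeta_i$ are $C^\infty$ and normalized so that $|\zeta_i|=1$. *)

theory Defs
  imports "HOL-Probability.Probability"
begin

text \<open>
  A manifold is a whole type together with an atlas of charts into a Euclidean space.
  \<open>C_k_on\<close> is only meant for open sets, since its derivatives are taken in the
  ambient space. The inverse of a chart map \<open>\<phi>\<close> on \<open>U\<close> is \<open>inv_into U \<phi>\<close>, which is
  arbitrary off \<open>\<phi> ` U\<close>.
\<close>

primrec C_k_on ::
  "nat \<Rightarrow> 'e::real_normed_vector set \<Rightarrow> ('e \<Rightarrow> 'f::real_normed_vector) \<Rightarrow> bool" where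
  "C_k_on 0 S f \<longleftrightarrow> continuous_on S f"
| "C_k_on (Suc k) S f \<longleftrightarrow>
     (\<forall>x\<in>S. f differentiable (at x)) \<and> (\<forall>h. C_k_on k S (\<lambda>x. frechet_derivative f (at x) h))"

definition smooth_on ::
  "'e::real_normed_vector set \<Rightarrow> ('e \<Rightarrow> 'f::real_normed_vector) \<Rightarrow> bool" where
  "smooth_on S f \<longleftrightarrow> (\<forall>k. C_k_on k S f)"

type_synonym ('a, 'e) chart = "'a set \<times> ('a \<Rightarrow> 'e)"

definition is_chart :: "('a::topological_space, 'e::euclidean_space) chart \<Rightarrow> bool" where
  "is_chart = (\<lambda>(U, \<phi>). open U \<and> open (\<phi> ` U) \<and> homeomorphism U (\<phi> ` U) \<phi> (inv_into U \<phi>))"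

definition smooth_compatible ::
  "('a::topological_space, 'e::euclidean_space) chart \<Rightarrow> ('a, 'e) chart \<Rightarrow> bool" where
  "smooth_compatible = (\<lambda>(U, \<phi>) (V, \<psi>).
     smooth_on (\<phi> ` (U \<inter> V)) (\<psi> \<circ> inv_into U \<phi>) \<and>
     smooth_on (\<psi> ` (U \<inter> V)) (\<phi> \<circ> inv_into V \<psi>))"

definition smooth_atlas ::
  "('a::{second_countable_topology,t2_space}, 'e::euclidean_space) chart set \<Rightarrow> bool" where
  "smooth_atlas A \<longleftrightarrow>
     (\<forall>c\<in>A. is_chart c) \<and> (\<Union>c\<in>A. fst c) = UNIV \<and> (\<forall>c\<in>A. \<forall>d\<in>A. smooth_compatible c d)"

definition orientable_atlas ::
  "('a::{second_countable_topology,t2_space}, real ^ 'm) chart set \<Rightarrow> bool" where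
  "orientable_atlas A \<longleftrightarrow>
     (\<exists>B. smooth_atlas B \<and> (\<forall>c\<in>A. \<forall>d\<in>B. smooth_compatible c d) \<and>
        (\<forall>(U, \<phi>)\<in>B. \<forall>(V, \<psi>)\<in>B. \<forall>x\<in>\<phi> ` (U \<inter> V).
           0 < det (matrix (frechet_derivative (\<psi> \<circ> inv_into U \<phi>) (at x)))))"

definition euclidean_atlas :: "('e::euclidean_space, 'e) chart set" where
  "euclidean_atlas = {(UNIV, \<lambda>x. x)}"

definition product_atlas ::
  "('a, 'e) chart set \<Rightarrow> ('b, 'f) chart set \<Rightarrow> ('a \<times> 'b, 'e \<times> 'f) chart set" where
  "product_atlas A B = {(U \<times> V, map_prod \<phi> \<psi>) | U \<phi> V \<psi>. (U, \<phi>) \<in> A \<and> (V, \<psi>) \<in> B}"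

definition smooth_map ::
  "('a::topological_space, 'e::euclidean_space) chart set \<Rightarrow>
   ('b::topological_space, 'f::euclidean_space) chart set \<Rightarrow> ('a \<Rightarrow> 'b) \<Rightarrow> bool" where
  "smooth_map A B F \<longleftrightarrow> continuous_on UNIV F \<and>
     (\<forall>(U, \<phi>)\<in>A. \<forall>(V, \<psi>)\<in>B. smooth_on (\<phi> ` (U \<inter> F -` V)) (\<psi> \<circ> F \<circ> inv_into U \<phi>))"

abbreviation smooth_fun ::
  "('a::topological_space, 'e::euclidean_space) chart set \<Rightarrow> ('a \<Rightarrow> 'f::euclidean_space) \<Rightarrow> bool" where
  "smooth_fun A f \<equiv> smooth_map A euclidean_atlas f"

text \<open>
  Tangent vectors at \<open>p\<close> are derivations at \<open>p\<close> of the algebra of real smooth functions.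
  Values at non-smooth functions are fixed to be \<open>0\<close>, so that equality of tangent vectors
  is equality of derivations.
\<close>

definition tangent_space ::
  "('a::topological_space, 'e::euclidean_space) chart set \<Rightarrow> 'a \<Rightarrow> (('a \<Rightarrow> real) \<Rightarrow> real) set" where
  "tangent_space A p = {X.
     (\<forall>f g. smooth_fun A f \<longrightarrow> smooth_fun A g \<longrightarrow> X (\<lambda>x. f x + g x) = X f + X g) \<and>
     (\<forall>c f. smooth_fun A f \<longrightarrow> X (\<lambda>x. c * f x) = c * X f) \<and>
     (\<forall>f g. smooth_fun A f \<longrightarrow> smooth_fun A g \<longrightarrow> X (\<lambda>x. f x * g x) = f p * X g + g p * X f) \<and>
     (\<forall>f. \<not> smooth_fun A f \<longrightarrow> X f = 0)}"

definition pushforward ::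
  "('b::topological_space, 'f::euclidean_space) chart set \<Rightarrow> ('a \<Rightarrow> 'b) \<Rightarrow>
   (('a \<Rightarrow> real) \<Rightarrow> real) \<Rightarrow> (('b \<Rightarrow> real) \<Rightarrow> real)" where
  "pushforward B F X = (\<lambda>g. if smooth_fun B g then X (g \<circ> F) else 0)"

definition smooth_vector_field ::
  "('a::topological_space, 'e::euclidean_space) chart set \<Rightarrow> ('a \<Rightarrow> ('a \<Rightarrow> real) \<Rightarrow> real) \<Rightarrow> bool" where
  "smooth_vector_field A v \<longleftrightarrow>
     (\<forall>p. v p \<in> tangent_space A p) \<and> (\<forall>f. smooth_fun A f \<longrightarrow> smooth_fun A (\<lambda>p. v p f))"

definition projectible ::
  "('a::topological_space, 'e::euclidean_space) chart set \<Rightarrow>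
   ('b::topological_space, 'f::euclidean_space) chart set \<Rightarrow>
   ('a \<Rightarrow> 'b) \<Rightarrow> ('a \<Rightarrow> ('a \<Rightarrow> real) \<Rightarrow> real) \<Rightarrow> bool" where
  "projectible A B F v \<longleftrightarrow>
     (\<forall>a b. F a = F b \<longrightarrow>
        pushforward B F (v a) \<in> tangent_space B (F a) \<and>
        pushforward B F (v b) \<in> tangent_space B (F b) \<and>
        pushforward B F (v a) = pushforward B F (v b))"

definition smooth_flow ::
  "('a::topological_space, 'e::euclidean_space) chart set \<Rightarrow> (real \<Rightarrow> 'a \<Rightarrow> 'a) \<Rightarrow> bool" where
  "smooth_flow A \<Phi> \<longleftrightarrow>
     (\<forall>x. \<Phi> 0 x = x) \<and> (\<forall>s t x. \<Phi> (s + t) x = \<Phi> s (\<Phi> t x)) \<and>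
     smooth_map (product_atlas euclidean_atlas A) A (\<lambda>(t, x). \<Phi> t x)"

definition generates_flow ::
  "('a::topological_space, 'e::euclidean_space) chart set \<Rightarrow>
   ('a \<Rightarrow> ('a \<Rightarrow> real) \<Rightarrow> real) \<Rightarrow> (real \<Rightarrow> 'a \<Rightarrow> 'a) \<Rightarrow> bool" where
  "generates_flow A v \<Phi> \<longleftrightarrow> smooth_vector_field A v \<and>
     (\<forall>f p. smooth_fun A f \<longrightarrow> ((\<lambda>t. (f (\<Phi> t p) - f p) / t) \<longlongrightarrow> v p f) (at 0))"

definition smooth_positive_density ::
  "('a::topological_space, 'e::euclidean_space) chart set \<Rightarrow> 'a measure \<Rightarrow> bool" where
  "smooth_positive_density A \<mu> \<longleftrightarrow>
     (\<forall>(U, \<phi>)\<in>A. \<exists>\<rho>. smooth_on (\<phi> ` U) \<rho> \<and> (\<forall>y\<in>\<phi> ` U. 0 < \<rho> y) \<and>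
        (\<forall>B\<in>sets borel. B \<subseteq> \<phi> ` U \<longrightarrow>
           emeasure \<mu> (U \<inter> \<phi> -` B) = (\<integral>\<^sup>+ y\<in>B. ennreal (\<rho> y) \<partial>lborel)))"

definition ergodic_discrete :: "'a measure \<Rightarrow> (real \<Rightarrow> 'a \<Rightarrow> 'a) \<Rightarrow> real \<Rightarrow> bool" where
  "ergodic_discrete \<mu> \<Phi> T \<longleftrightarrow>
     (\<forall>E\<in>sets \<mu>. (\<forall>n::int. \<Phi> (of_int n * T) -` E \<inter> space \<mu> = E) \<longrightarrow>
        emeasure \<mu> E = 0 \<or> emeasure \<mu> E = 1)"

definition square_integrable :: "'a measure \<Rightarrow> ('a \<Rightarrow> complex) \<Rightarrow> bool" where
  "square_integrable \<mu> f \<longleftrightarrow>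
     f \<in> borel_measurable \<mu> \<and> integrable \<mu> (\<lambda>x. (cmod (f x))\<^sup>2)"

definition l2norm :: "'a measure \<Rightarrow> ('a \<Rightarrow> complex) \<Rightarrow> real" where
  "l2norm \<mu> f = sqrt (\<integral>x. (cmod (f x))\<^sup>2 \<partial>\<mu>)"

definition koopman :: "(real \<Rightarrow> 'a \<Rightarrow> 'a) \<Rightarrow> real \<Rightarrow> ('a \<Rightarrow> complex) \<Rightarrow> ('a \<Rightarrow> complex)" where
  "koopman \<Phi> t f = f \<circ> \<Phi> t"

text \<open>
  The graph of the infinitesimal generator of the unitary group \<open>koopman \<Phi>\<close> on \<open>L\<^sup>2(\<mu>)\<close>:
  \<open>f\<close> lies in its domain and is mapped to (the class of) \<open>g\<close>.
\<close>

definition koopman_generator ::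
  "'a measure \<Rightarrow> (real \<Rightarrow> 'a \<Rightarrow> 'a) \<Rightarrow> ('a \<Rightarrow> complex) \<Rightarrow> ('a \<Rightarrow> complex) \<Rightarrow> bool" where
  "koopman_generator \<mu> \<Phi> f g \<longleftrightarrow> square_integrable \<mu> f \<and> square_integrable \<mu> g \<and>
     ((\<lambda>t. l2norm \<mu> (\<lambda>x. (koopman \<Phi> t f x - f x) / of_real t - g x)) \<longlongrightarrow> 0) (at 0)"

definition koopman_eigenfunction ::
  "'a measure \<Rightarrow> (real \<Rightarrow> 'a \<Rightarrow> 'a) \<Rightarrow> complex \<Rightarrow> ('a \<Rightarrow> complex) \<Rightarrow> bool" where
  "koopman_eigenfunction \<mu> \<Phi> c f \<longleftrightarrow>
     koopman_generator \<mu> \<Phi> f (\<lambda>x. c * f x) \<and> \<not> (AE x in \<mu>. f x = 0)"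

definition orthonormal_basis :: "'a measure \<Rightarrow> ('k \<Rightarrow> 'a \<Rightarrow> complex) \<Rightarrow> bool" where
  "orthonormal_basis \<mu> z \<longleftrightarrow>
     (\<forall>k. square_integrable \<mu> (z k)) \<and>
     (\<forall>k l. (\<integral>x. z k x * cnj (z l x) \<partial>\<mu>) = (if k = l then 1 else 0)) \<and>
     (\<forall>f \<epsilon>. square_integrable \<mu> f \<longrightarrow> 0 < \<epsilon> \<longrightarrow>
        (\<exists>K c. finite K \<and> l2norm \<mu> (\<lambda>x. f x - (\<Sum>k\<in>K. c k * z k x)) < \<epsilon>))"

definition rationally_independent :: "('m::finite \<Rightarrow> real) \<Rightarrow> bool" where
  "rationally_independent \<Omega> \<longleftrightarrow>
     (\<forall>k::'m \<Rightarrow> int. (\<Sum>i\<in>UNIV. of_int (k i) * \<Omega> i) = 0 \<longrightarrow> (\<forall>i. k i = 0))"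

definition monomial_eigenfunction ::
  "('m::finite \<Rightarrow> 'a \<Rightarrow> complex) \<Rightarrow> ('m \<Rightarrow> int) \<Rightarrow> 'a \<Rightarrow> complex" where
  "monomial_eigenfunction \<zeta> k x = (\<Prod>i\<in>UNIV. \<zeta> i x powi k i)"

end

theory Submission
  imports Defs
begin

text \<open>
  Since \<open>\<zeta> \<circ> \<Phi> t\<close> is pointwise differentiable in \<open>t\<close>, Fatou's lemma identifies its derivative
  at \<open>t = 0\<close> with the \<open>L\<^sup>2\<close> derivative \<open>\<i> \<Omega> \<zeta>\<close> almost everywhere, and hence everywhere by
  continuity, because \<open>\<mu>\<close> charges every nonempty open set. By the chain rule the pushforward of
  \<open>v\<close> at \<open>a\<close> is then the derivative in the direction \<open>\<i> \<Omega> \<zeta>(a)\<close>, which depends on \<open>\<zeta>(a)\<close> only.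
\<close>

section \<open>Calculus of \<open>C_k_on\<close> on open sets\<close>

lemma C_k_on_cong:
  assumes "open S" "\<And>x. x \<in> S \<Longrightarrow> f x = g x" "C_k_on k S f"
  shows "C_k_on k S g"
  using assms(2,3)
proof (induction k arbitrary: f g)
  case 0
  then show ?case using continuous_on_eq[of S f g] by simp
next
  case (Suc k)
  have D: "(g has_derivative frechet_derivative f (at x)) (at x)" if "x \<in> S" for x
  proof (rule has_derivative_transform_within_open[OF _ assms(1) that Suc.prems(1)])
    show "(f has_derivative frechet_derivative f (at x)) (at x)"
      using Suc.prems(2) that frechet_derivative_works by (metis C_k_on.simps(2))
  qed
  then have "frechet_derivative f (at x) = frechet_derivative g (at x)" if "x \<in> S" for x
    using that frechet_derivative_at by blast
  then have "C_k_on k S (\<lambda>x. frechet_derivative g (at x) h)" for h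
    using Suc.prems(2) Suc.IH[of "\<lambda>x. frechet_derivative f (at x) h"
        "\<lambda>x. frechet_derivative g (at x) h"]
    by simp
  with D show ?case
    unfolding C_k_on.simps differentiable_def by blast
qed

text \<open>\<open>frechet_derivative\<close> is defined by choice, but derivatives are unique, so
  any explicit formula \<open>f'\<close> may stand in for it on the open set. The closure proofs for
  constants, sums, products and composites each supply their differentiation formula through this
  rule.\<close>

lemma C_k_on_SucI:
  assumes "open S" "\<And>x. x \<in> S \<Longrightarrow> (f has_derivative f' x) (at x)"
    and "\<And>h. C_k_on k S (\<lambda>x. f' x h)"
  shows "C_k_on (Suc k) S f"
proof -
  have "f' x = frechet_derivative f (at x)" if "x \<in> S" for x
    using assms(2)[OF that] frechet_derivative_at by blast
  then have "C_k_on k S (\<lambda>x. frechet_derivative f (at x) h)" for h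
    using assms(1,3) by (intro C_k_on_cong[OF _ _ assms(3)]) auto
  then show ?thesis
    using assms(2) by (auto simp: differentiable_def)
qed

lemma C_k_on_has_derivative:
  assumes "C_k_on (Suc k) S f" "x \<in> S"
  shows "(f has_derivative frechet_derivative f (at x)) (at x)"
  using assms by (simp add: frechet_derivative_works)

lemma C_k_on_SucD:
  "C_k_on (Suc k) S f \<Longrightarrow> C_k_on k S f"
proof (induction k arbitrary: f)
  case 0
  then show ?case
    by (auto intro!: continuous_at_imp_continuous_on differentiable_imp_continuous_within)
next
  case (Suc k)
  then show ?case by (metis C_k_on.simps(2))
qed

lemma C_k_on_const: "open S \<Longrightarrow> C_k_on k S (\<lambda>x. c)"
proof (induction k arbitrary: c)
  case (Suc k)
  then show ?case by (intro C_k_on_SucI[where f' = "\<lambda>x h. 0"]) auto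
qed simp

lemma C_k_on_add:
  assumes "open S" "C_k_on k S f" "C_k_on k S g"
  shows "C_k_on k S (\<lambda>x. f x + g x)"
  using assms(2,3)
proof (induction k arbitrary: f g)
  case (Suc k)
  show ?case
    using Suc.prems Suc.IH
    by (intro C_k_on_SucI[OF assms(1),
          where f' = "\<lambda>x h. frechet_derivative f (at x) h + frechet_derivative g (at x) h"]
        has_derivative_add C_k_on_has_derivative) auto
qed (simp add: continuous_on_add)

lemma C_k_on_sum:
  assumes "open S" "\<And>i. i \<in> I \<Longrightarrow> C_k_on k S (f i)"
  shows "C_k_on k S (\<lambda>x. \<Sum>i\<in>I. f i x)"
  using assms(2)
  by (induction I rule: infinite_finite_induct) (auto intro: C_k_on_const C_k_on_add assms(1))

text \<open>By the product rule the derivative is a sum of two terms of the same bilinear shape, so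
  the induction closes with \<open>f\<close> and \<open>g\<close> varying. A general
  \<open>B\<close> covers scalar multiplication, the inner product and real multiplication at
  once.\<close>

lemma C_k_on_bilinear:
  assumes "bounded_bilinear B" "open S" "C_k_on k S f" "C_k_on k S g"
  shows "C_k_on k S (\<lambda>x. B (f x) (g x))"
  using assms(3,4)
proof (induction k arbitrary: f g)
  case 0
  then show ?case using bounded_bilinear.continuous_on[OF assms(1)] by simp
next
  case (Suc k)
  show ?case
  proof (rule C_k_on_SucI[OF assms(2), where
        f' = "\<lambda>x h. B (f x) (frechet_derivative g (at x) h) + B (frechet_derivative f (at x) h) (g x)"])
    show "((\<lambda>x. B (f x) (g x)) has_derivative
        (\<lambda>h. B (f x) (frechet_derivative g (at x) h) + B (frechet_derivative f (at x) h) (g x))) (at x)"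
      if "x \<in> S" for x
      using Suc.prems that by (intro bounded_bilinear.FDERIV[OF assms(1)] C_k_on_has_derivative)
    show "C_k_on k S (\<lambda>x. B (f x) (frechet_derivative g (at x) h)
        + B (frechet_derivative f (at x) h) (g x))" for h
      using Suc.prems C_k_on_SucD[OF Suc.prems(1)] C_k_on_SucD[OF Suc.prems(2)]
      by (intro C_k_on_add Suc.IH assms(2)) auto
  qed
qed

text \<open>\<open>C_k_on\<close> controls derivatives in a fixed direction, whereas the chain rule
  feeds the derivative of \<open>g\<close> a direction that moves with \<open>x\<close>. Expanding
  that direction in \<open>Basis\<close> leaves finitely many fixed directions, and the induction
  hypothesis applies to the partial derivatives of \<open>g\<close>; hence only \<open>g\<close> is
  generalized.\<close>

lemma C_k_on_compose:
  fixes f :: "'e::real_normed_vector \<Rightarrow> 'f::euclidean_space" and g :: "'f \<Rightarrow> 'g::real_normed_vector"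
  assumes "open S" "f ` S \<subseteq> V" "C_k_on k S f" "C_k_on k V g"
  shows "C_k_on k S (\<lambda>x. g (f x))"
  using assms(3,4)
proof (induction k arbitrary: g)
  case 0
  then show ?case using assms(2) by (auto intro: continuous_on_compose2)
next
  case (Suc k)
  let ?f' = "\<lambda>x h. frechet_derivative f (at x) h"
  let ?g' = "\<lambda>y h. frechet_derivative g (at y) h"
  show ?case
  proof (rule C_k_on_SucI[OF assms(1), where
        f' = "\<lambda>x h. \<Sum>b\<in>Basis. (?f' x h \<bullet> b) *\<^sub>R ?g' (f x) b"])
    fix x assume x: "x \<in> S"
    then have g: "(g has_derivative ?g' (f x)) (at (f x))"
      using Suc.prems assms(2) by (auto intro!: C_k_on_has_derivative)
    have "((\<lambda>x. g (f x)) has_derivative (\<lambda>h. ?g' (f x) (?f' x h))) (at x)"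
      using has_derivative_compose[OF C_k_on_has_derivative[OF Suc.prems(1) x] g] .
    moreover have "?g' (f x) y = (\<Sum>b\<in>Basis. (y \<bullet> b) *\<^sub>R ?g' (f x) b)" for y
    proof -
      have "linear (?g' (f x))" using g by (rule has_derivative_linear)
      then have "?g' (f x) (\<Sum>b\<in>Basis. (y \<bullet> b) *\<^sub>R b) = (\<Sum>b\<in>Basis. (y \<bullet> b) *\<^sub>R ?g' (f x) b)"
        by (simp add: linear_sum linear_cmul)
      then show ?thesis by (simp add: euclidean_representation)
    qed
    ultimately show "((\<lambda>x. g (f x)) has_derivative
        (\<lambda>h. \<Sum>b\<in>Basis. (?f' x h \<bullet> b) *\<^sub>R ?g' (f x) b)) (at x)"
      by (rule has_derivative_eq_rhs[OF _ ext])
  next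
    show "C_k_on k S (\<lambda>x. \<Sum>b\<in>Basis. (?f' x h \<bullet> b) *\<^sub>R ?g' (f x) b)" for h
    proof -
      have "C_k_on k S (\<lambda>x. ?g' (f x) b)" for b
        using Suc.prems(2) by (intro Suc.IH C_k_on_SucD[OF Suc.prems(1)]) simp
      then show ?thesis
        using Suc.prems(1)
        by (intro C_k_on_sum C_k_on_bilinear[OF bounded_bilinear_scaleR]
            C_k_on_bilinear[OF bounded_bilinear_inner] C_k_on_const assms(1)) simp_all
    qed
  qed
qed

lemma smooth_on_bounded_linear:
  assumes "bounded_linear L" "open S"
  shows "smooth_on S L"
  unfolding smooth_on_def
proof
  fix k show "C_k_on k S L"
  proof (cases k)
    case 0
    then show ?thesis using assms(1) by (simp add: linear_continuous_on)
  next
    case (Suc j)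
    then show ?thesis
      using assms by (auto intro!: C_k_on_SucI[where f' = "\<lambda>x. L"] C_k_on_const
          bounded_linear_imp_has_derivative simp del: C_k_on.simps)
  qed
qed

section \<open>Smooth functions on an atlas and pushforwards of tangent vectors\<close>

lemma smooth_fun_iff:
  "smooth_fun A f \<longleftrightarrow>
    continuous_on UNIV f \<and> (\<forall>(U, \<phi>)\<in>A. smooth_on (\<phi> ` U) (f \<circ> inv_into U \<phi>))"
  by (simp add: smooth_map_def euclidean_atlas_def comp_def)

lemma smooth_fun_euclidean_iff:
  "smooth_fun euclidean_atlas f \<longleftrightarrow> smooth_on UNIV f"
proof -
  have "inv_into UNIV (\<lambda>x. x) = (\<lambda>x::'a. x)"
    using inv_id[unfolded id_def] .
  then show ?thesis
    unfolding smooth_fun_iff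
    by (auto simp: euclidean_atlas_def comp_def smooth_on_def dest: spec[of _ 0])
qed

lemma smooth_fun_compose:
  assumes "smooth_atlas A" "smooth_fun A f" "smooth_on UNIV g"
  shows "smooth_fun A (g \<circ> f)"
  unfolding smooth_fun_iff
proof (intro conjI ballI, safe)
  have "continuous_on UNIV g" using assms(3) by (auto simp: smooth_on_def dest: spec[of _ 0])
  then show "continuous_on UNIV (g \<circ> f)"
    using assms(2) unfolding smooth_fun_iff by (metis continuous_on_compose continuous_on_subset subset_UNIV)
  fix U \<phi> assume c: "(U, \<phi>) \<in> A"
  then have "open (\<phi> ` U)" using assms(1) by (auto simp: smooth_atlas_def is_chart_def)
  moreover have "smooth_on (\<phi> ` U) (f \<circ> inv_into U \<phi>)"
    using c assms(2) by (auto simp: smooth_fun_iff)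
  ultimately show "smooth_on (\<phi> ` U) ((g \<circ> f) \<circ> inv_into U \<phi>)"
    using assms(3) C_k_on_compose[of "\<phi> ` U" "f \<circ> inv_into U \<phi>" UNIV _ g]
    by (auto simp: smooth_on_def comp_def)
qed

text \<open>Composition with \<open>F\<close> respects sums, scalar multiples and products, so the
  derivation rules of \<open>X\<close> carry over. The closure facts collected first keep
  \<open>pushforward\<close> out of its default branch \<open>0\<close> while these rules are
  checked.\<close>

lemma pushforward_in_tangent_space:
  assumes A: "smooth_atlas A" and F: "smooth_fun A F" and X: "X \<in> tangent_space A p"
  shows "pushforward euclidean_atlas F X \<in> tangent_space euclidean_atlas (F p)"
proof -
  have add: "smooth_on UNIV (\<lambda>x. f x + g x)" if "smooth_on UNIV f" "smooth_on UNIV g"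
    for f g :: "'c \<Rightarrow> real"
    using that by (auto simp: smooth_on_def intro: C_k_on_add)
  have mult: "smooth_on UNIV (\<lambda>x. f x * g x)" if "smooth_on UNIV f" "smooth_on UNIV g"
    for f g :: "'c \<Rightarrow> real"
    using that by (auto simp: smooth_on_def intro: C_k_on_bilinear[OF bounded_bilinear_mult])
  have const: "smooth_on UNIV (\<lambda>x. c)" for c :: real
    by (simp add: smooth_on_def C_k_on_const)
  note comp = smooth_fun_compose[OF A F, unfolded comp_def]
  show ?thesis
    using X unfolding tangent_space_def mem_Collect_eq pushforward_def smooth_fun_euclidean_iff comp_def
    by (simp add: add mult const comp)
qed

section \<open>Positivity of the measure on nonempty open sets\<close>

lemma open_positive_emeasure_lborel:
  fixes B :: "'e::euclidean_space set"
  assumes "open B" "B \<noteq> {}"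
  shows "0 < emeasure lborel B"
proof -
  have "B \<notin> null_sets lebesgue"
    using open_not_negligible[OF assms] by (simp add: negligible_iff_null_sets)
  then show ?thesis
    using assms(1) by (auto simp: null_sets_def zero_less_iff_neq_zero)
qed

text \<open>Shrinking \<open>W\<close> to a chart domain around \<open>p\<close> turns the measure
  into the integral of a positive density over a nonempty open set of Euclidean space.\<close>

lemma smooth_positive_density_pos:
  fixes A :: "('a::{second_countable_topology,t2_space}, 'e::euclidean_space) chart set"
  assumes A: "smooth_atlas A" and d: "smooth_positive_density A \<mu>" and s: "sets \<mu> = sets borel"
    and W: "open W" "p \<in> W"
  shows "0 < emeasure \<mu> W"
proof -
  obtain U \<phi> where c: "(U, \<phi>) \<in> A" "p \<in> U"
    using A unfolding smooth_atlas_def by (metis UNIV_I UN_E prod.collapse)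
  with A have o: "open U" "open (\<phi> ` U)" and h: "homeomorphism U (\<phi> ` U) \<phi> (inv_into U \<phi>)"
    by (auto simp: smooth_atlas_def is_chart_def)
  obtain \<rho> where \<rho>: "smooth_on (\<phi> ` U) \<rho>" "\<And>y. y \<in> \<phi> ` U \<Longrightarrow> 0 < \<rho> y"
    and e: "\<And>B. B \<in> sets borel \<Longrightarrow> B \<subseteq> \<phi> ` U \<Longrightarrow>
      emeasure \<mu> (U \<inter> \<phi> -` B) = (\<integral>\<^sup>+ y\<in>B. ennreal (\<rho> y) \<partial>lborel)"
    using bspec[OF d[unfolded smooth_positive_density_def] c(1)] by auto
  define B where "B = \<phi> ` (U \<inter> W)"
  have BU: "B \<subseteq> \<phi> ` U" and Bp: "\<phi> p \<in> B" using W(2) c(2) by (auto simp: B_def)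
  have "openin (top_of_set (\<phi> ` U)) B"
    unfolding B_def by (rule homeomorphism_imp_open_map[OF h]) (use W(1) in auto)
  then have B: "open B" using o(2) openin_open_trans by blast
  have cont: "continuous_on (\<phi> ` U) \<rho>" using \<rho>(1) by (auto simp: smooth_on_def dest: spec[of _ 0])
  \<comment> \<open>Nothing is known of \<open>\<rho>\<close> outside the chart image, so
    measurability is obtained after cutting down to \<open>B\<close>, where \<open>\<rho>\<close> is
    continuous.\<close>
  have "(\<lambda>y. indicator B y *\<^sub>R \<rho> y) \<in> borel_measurable borel"
    using B continuous_on_subset[OF cont BU] by (intro borel_measurable_continuous_on_indicator) auto
  then have "(\<lambda>y. ennreal (indicator B y *\<^sub>R \<rho> y)) \<in> borel_measurable lborel"
    by measurable
  moreover have eq: "ennreal (\<rho> y) * indicator B y = ennreal (indicator B y *\<^sub>R \<rho> y)" for y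
    by (simp add: indicator_def)
  ultimately have m: "(\<lambda>y. ennreal (\<rho> y) * indicator B y) \<in> borel_measurable lborel"
    by simp
  \<comment> \<open>A vanishing integral would make the integrand zero almost everywhere; as
    \<open>\<rho>\<close> is positive on \<open>B\<close>, this would make \<open>B\<close> a null
    set.\<close>
  have "(\<integral>\<^sup>+ y\<in>B. ennreal (\<rho> y) \<partial>lborel) \<noteq> 0"
  proof
    assume "(\<integral>\<^sup>+ y\<in>B. ennreal (\<rho> y) \<partial>lborel) = 0"
    then have "AE y in lborel. ennreal (\<rho> y) * indicator B y = 0"
      using nn_integral_0_iff_AE[OF m] by simp
    then have "AE y in lborel. y \<notin> B"
      by eventually_elim (use \<rho>(2) BU in \<open>force simp: indicator_def ennreal_eq_0_iff\<close>)
    then have "emeasure lborel B = 0"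
      using AE_iff_measurable[of B lborel "\<lambda>y. y \<notin> B"] B by auto
    with open_positive_emeasure_lborel[OF B] Bp show False by auto
  qed
  then have "emeasure \<mu> (U \<inter> \<phi> -` B) \<noteq> 0" using e[of B] B BU by simp
  \<comment> \<open>Injectivity ensures that pulling \<open>B\<close> back to \<open>U\<close> gives
    exactly \<open>U \<inter> W\<close>.\<close>
  moreover have "inj_on \<phi> U"
    using homeomorphism_apply1[OF h] by (rule inj_on_inverseI)
  then have "U \<inter> \<phi> -` B = U \<inter> W"
    unfolding B_def using inj_on_image_mem_iff[of \<phi> U _ "U \<inter> W"] by blast
  moreover have "emeasure \<mu> (U \<inter> W) \<le> emeasure \<mu> W"
    using W(1) s by (intro emeasure_mono) auto
  ultimately show ?thesis by (auto simp: zero_less_iff_neq_zero)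
qed

section \<open>Pointwise derivatives along the flow and the Koopman generator\<close>

lemma smooth_flow_continuous:
  assumes "smooth_flow A \<Phi>"
  shows "continuous_on UNIV (\<Phi> t)"
proof -
  have "continuous_on UNIV (\<lambda>(t, x). \<Phi> t x)"
    using assms by (simp add: smooth_flow_def smooth_map_def)
  then have "continuous_on UNIV ((\<lambda>(t, x). \<Phi> t x) \<circ> (\<lambda>x. (t, x)))"
    by (intro continuous_on_compose continuous_intros) (auto intro: continuous_on_subset)
  then show ?thesis by (simp add: comp_def)
qed

text \<open>\<open>v\<close> acts on real functions only, so the derivative of \<open>f\<close> is
  assembled from real and imaginary parts. It is continuous because \<open>v\<close> maps smooth
  functions to smooth functions.\<close>

lemma generates_flow_complex:
  fixes f :: "'a::{second_countable_topology,t2_space} \<Rightarrow> complex"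
  assumes A: "smooth_atlas A" and gen: "generates_flow A v \<Phi>" and f: "smooth_fun A f"
  obtains f' where "continuous_on UNIV f'"
    and "\<And>p. ((\<lambda>t. (f (\<Phi> t p) - f p) / of_real t) \<longlongrightarrow> f' p) (at 0)"
proof
  let ?f' = "\<lambda>p. Complex (v p (Re \<circ> f)) (v p (Im \<circ> f))"
  have s: "smooth_fun A (Re \<circ> f)" "smooth_fun A (Im \<circ> f)"
    by (intro smooth_fun_compose[OF A f] smooth_on_bounded_linear bounded_linear_Re
        bounded_linear_Im open_UNIV)+
  have "smooth_fun A (\<lambda>p. v p g)" if "smooth_fun A g" for g
    using gen that by (auto simp: generates_flow_def smooth_vector_field_def)
  then have "continuous_on UNIV (\<lambda>p. v p g)" if "smooth_fun A g" for g
    using that unfolding smooth_fun_iff by blast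
  from this[OF s(1)] this[OF s(2)] show "continuous_on UNIV ?f'"
    unfolding Complex_eq by (intro continuous_intros)
  fix p
  have "((\<lambda>t. (g (\<Phi> t p) - g p) / t) \<longlongrightarrow> v p g) (at 0)" if "smooth_fun A g" for g
    using gen that by (auto simp: generates_flow_def)
  from this[OF s(1)] this[OF s(2)]
  have "((\<lambda>t. Complex ((Re (f (\<Phi> t p)) - Re (f p)) / t) ((Im (f (\<Phi> t p)) - Im (f p)) / t))
      \<longlongrightarrow> ?f' p) (at 0)"
    by (auto intro: tendsto_Complex)
  moreover have "Complex ((Re z - Re w) / t) ((Im z - Im w) / t) = (z - w) / of_real t" for z w t
    by (simp add: complex_eq_iff)
  ultimately show "((\<lambda>t. (f (\<Phi> t p) - f p) / of_real t) \<longlongrightarrow> ?f' p) (at 0)"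
    by simp
qed

text \<open>The difference quotients tend to \<open>f'\<close> pointwise and to \<open>g\<close> in
  mean square. By Fatou's lemma the integral of the squared modulus of \<open>f' - g\<close> is at
  most the liminf of the squared errors, which is zero.\<close>

lemma koopman_generator_pointwise_AE:
  fixes f f' g :: "'a::topological_space \<Rightarrow> complex"
  assumes \<mu>: "prob_space \<mu>" and s: "sets \<mu> = sets borel"
    and \<Phi>: "\<And>t. continuous_on UNIV (\<Phi> t)"
    and f: "continuous_on UNIV f" "\<And>x. cmod (f x) \<le> C"
    and g: "continuous_on UNIV g" "\<And>x. cmod (g x) \<le> D"
    and lim: "\<And>p. ((\<lambda>t. (f (\<Phi> t p) - f p) / of_real t) \<longlongrightarrow> f' p) (at 0)"
    and gen: "koopman_generator \<mu> \<Phi> f g"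
  shows "AE x in \<mu>. f' x = g x"
proof -
  interpret prob_space \<mu> by fact
  \<comment> \<open>Fatou's lemma needs a sequence of times; the successor keeps them
    nonzero.\<close>
  define h where "h n x = (f (\<Phi> (1 / real (Suc n)) x) - f x) / of_real (1 / real (Suc n)) - g x"
    for n x
  have t0: "filterlim (\<lambda>n. 1 / real (Suc n)) (at 0) sequentially"
    using LIMSEQ_inverse_real_of_nat by (auto simp: filterlim_at inverse_eq_divide)
  have hlim: "(\<lambda>n. h n x) \<longlonglongrightarrow> f' x - g x" for x
    unfolding h_def by (intro tendsto_diff filterlim_compose[OF lim t0] tendsto_const)
  have "continuous_on UNIV (h n)" for n
    unfolding h_def
    by (intro continuous_intros continuous_on_compose2[OF f(1) \<Phi>] f(1) g(1)) (auto simp del: of_nat_Suc)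
  then have m: "h n \<in> borel_measurable \<mu>" for n
    using s borel_measurable_continuous_onI measurable_cong_sets by blast
  \<comment> \<open>The bound grows with \<open>n\<close>, which is harmless: it only makes each
    square integrable, so that the Bochner integral in \<open>l2norm\<close> agrees with the
    nonnegative integral in Fatou's lemma.\<close>
  have bound: "cmod (h n x) \<le> (C + C) * real (Suc n) + D" for n x
  proof -
    have "cmod (h n x) \<le> cmod (f (\<Phi> (1 / real (Suc n)) x) - f x) * real (Suc n) + cmod (g x)"
      unfolding h_def by (rule order_trans[OF norm_triangle_ineq4]) (simp add: norm_mult norm_divide del: of_nat_Suc)
    also have "\<dots> \<le> (C + C) * real (Suc n) + D"
      by (intro add_mono mult_right_mono g(2) order_trans[OF norm_triangle_ineq4] f(2)) auto
    finally show ?thesis .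
  qed
  have int: "integrable \<mu> (\<lambda>x. (cmod (h n x))\<^sup>2)" for n
    using m bound[of n]
    by (intro integrable_const_bound[where B = "((C + C) * real (Suc n) + D)\<^sup>2"])
      (auto intro!: AE_I2 power_mono simp del: of_nat_Suc)
  have "(\<lambda>n. l2norm \<mu> (h n)) \<longlonglongrightarrow> 0"
    using filterlim_compose[OF conjunct2[OF conjunct2[OF gen[unfolded koopman_generator_def]]] t0]
    by (simp add: h_def[abs_def] koopman_def)
  then have "(\<lambda>n. (l2norm \<mu> (h n))\<^sup>2) \<longlonglongrightarrow> 0\<^sup>2" by (rule tendsto_power)
  then have "(\<lambda>n. \<integral>x. (cmod (h n x))\<^sup>2 \<partial>\<mu>) \<longlonglongrightarrow> 0"
    by (simp add: l2norm_def)
  then have "(\<lambda>n. ennreal (\<integral>x. (cmod (h n x))\<^sup>2 \<partial>\<mu>)) \<longlonglongrightarrow> ennreal 0"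
    by (rule tendsto_ennrealI)
  then have "(\<lambda>n. \<integral>\<^sup>+x. ennreal ((cmod (h n x))\<^sup>2) \<partial>\<mu>) \<longlonglongrightarrow> 0"
    using int by (simp add: nn_integral_eq_integral)
  then have l: "liminf (\<lambda>n. \<integral>\<^sup>+x. ennreal ((cmod (h n x))\<^sup>2) \<partial>\<mu>) = 0"
    by (intro lim_imp_Liminf) auto
  have "liminf (\<lambda>n. ennreal ((cmod (h n x))\<^sup>2)) = ennreal ((cmod (f' x - g x))\<^sup>2)" for x
    by (intro lim_imp_Liminf tendsto_intros tendsto_ennrealI hlim) auto
  then have "(\<integral>\<^sup>+x. ennreal ((cmod (f' x - g x))\<^sup>2) \<partial>\<mu>) \<le> 0"
    using nn_integral_liminf[of "\<lambda>n x. ennreal ((cmod (h n x))\<^sup>2)" \<mu>] m l by simp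
  \<comment> \<open>Here \<open>f'\<close> is given only as a pointwise limit, so measurability is
    inherited from the \<open>h n\<close>.\<close>
  moreover have "(\<lambda>x. f' x - g x) \<in> borel_measurable \<mu>"
    using m hlim by (rule borel_measurable_LIMSEQ_metric)
  ultimately show ?thesis
    by (subst (asm) le_zero_eq, subst (asm) nn_integral_0_iff_AE) auto
qed

text \<open>Passes from limits of complex difference quotients, the form in which the flow
  derivative arrives, to the linear approximation form that the chain rule takes.\<close>

lemma has_vector_derivative_at_0I:
  fixes f :: "real \<Rightarrow> complex"
  assumes "((\<lambda>t. (f t - f 0) / of_real t) \<longlongrightarrow> w) (at 0)"
  shows "(f has_vector_derivative w) (at 0)"
proof -
  have "((\<lambda>t. norm ((f t - f 0) / of_real t - w)) \<longlongrightarrow> 0) (at 0)"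
    using assms tendsto_norm_zero LIM_zero by blast
  moreover have "norm ((f t - f 0) / of_real t - w) = norm (f t - f 0 - t *\<^sub>R w) / \<bar>t\<bar>"
    if "t \<noteq> 0" for t
  proof -
    have "(f t - f 0) / of_real t - w = (f t - f 0 - t *\<^sub>R w) / of_real t"
      using that by (simp add: scaleR_conv_of_real diff_divide_distrib)
    then show ?thesis by (simp only: norm_divide norm_of_real)
  qed
  ultimately have "((\<lambda>t. norm (f t - f 0 - t *\<^sub>R w) / \<bar>t\<bar>) \<longlongrightarrow> 0) (at 0)"
    by (rule Lim_cong_within[THEN iffD1, OF refl refl refl, rotated])
  then show ?thesis
    by (simp add: has_vector_derivative_def has_derivative_iff_norm bounded_linear_scaleR_left)
qed

text \<open>The set where two continuous functions differ is open, and a nonempty open set has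
  positive measure.\<close>

lemma AE_eq_imp_eq:
  fixes f g :: "'a::{second_countable_topology,t2_space} \<Rightarrow> complex"
  assumes A: "smooth_atlas A" "smooth_positive_density A \<mu>" and s: "sets \<mu> = sets borel"
    and c: "continuous_on UNIV f" "continuous_on UNIV g" and ae: "AE x in \<mu>. f x = g x"
  shows "f p = g p"
proof (rule ccontr)
  assume ne: "f p \<noteq> g p"
  have o: "open {x. f x \<noteq> g x}"
    using c by (rule open_Collect_neq)
  have "space \<mu> = UNIV" using sets_eq_imp_space_eq[OF s] by simp
  then have "emeasure \<mu> {x. f x \<noteq> g x} = 0"
    using ae o s by (subst (asm) AE_iff_measurable[of "{x. f x \<noteq> g x}"]) auto
  with smooth_positive_density_pos[OF A s o] ne show False by simp
qed

section \<open>Projectibility of the vector field\<close>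

theorem proposition4:
  fixes A :: "('a::{second_countable_topology,t2_space}, real ^ 'm) chart set"
    and \<mu> :: "'a measure"
    and \<Phi> :: "real \<Rightarrow> 'a \<Rightarrow> 'a"
    and v :: "'a \<Rightarrow> ('a \<Rightarrow> real) \<Rightarrow> real"
    and T :: real
    and \<Omega> :: "'m \<Rightarrow> real"
    and \<zeta> :: "'m \<Rightarrow> 'a \<Rightarrow> complex"
  assumes "smooth_atlas A" and "compact (UNIV :: 'a set)" and "connected (UNIV :: 'a set)"
    and "orientable_atlas A"
    and "smooth_flow A \<Phi>" and "generates_flow A v \<Phi>"
    and "prob_space \<mu>" and "sets \<mu> = sets borel"
    and "\<And>t. distr \<mu> \<mu> (\<Phi> t) = \<mu>"
    and "smooth_positive_density A \<mu>"
    and "0 < T" and "ergodic_discrete \<mu> \<Phi> T"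
    and "rationally_independent \<Omega>"
    and "\<And>i. koopman_eigenfunction \<mu> \<Phi> (\<i> * of_real (\<Omega> i)) (\<zeta> i)"
    and "\<And>k. koopman_eigenfunction \<mu> \<Phi> (\<i> * of_real (\<Sum>i\<in>UNIV. of_int (k i) * \<Omega> i))
           (monomial_eigenfunction \<zeta> k)"
    and "orthonormal_basis \<mu> (monomial_eigenfunction \<zeta>)"
    and "\<And>i. smooth_fun A (\<zeta> i)"
    and "\<And>i x. cmod (\<zeta> i x) = 1"
  shows "\<forall>i. projectible A (euclidean_atlas :: (complex, complex) chart set) (\<zeta> i) v"
proof
  fix i
  let ?w = "\<lambda>x. \<i> * of_real (\<Omega> i) * \<zeta> i x"
  note A = assms(1) and gen = assms(6) and \<zeta> = assms(17)[of i]
  have cont: "continuous_on UNIV (\<zeta> i)" using \<zeta> by (simp add: smooth_fun_iff)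
  then have contw: "continuous_on UNIV ?w" by (intro continuous_intros)
  obtain \<zeta>' where \<zeta>': "continuous_on UNIV \<zeta>'"
    and lim: "\<And>p. ((\<lambda>t. (\<zeta> i (\<Phi> t p) - \<zeta> i p) / of_real t) \<longlongrightarrow> \<zeta>' p) (at 0)"
    using generates_flow_complex[OF A gen \<zeta>] by blast
  have "AE x in \<mu>. \<zeta>' x = ?w x"
  proof (rule koopman_generator_pointwise_AE[OF assms(7,8) smooth_flow_continuous[OF assms(5)]
        cont _ contw _ lim])
    show "koopman_generator \<mu> \<Phi> (\<zeta> i) ?w"
      using assms(14)[of i] by (simp add: koopman_eigenfunction_def)
    show "cmod (\<zeta> i x) \<le> 1" "cmod (?w x) \<le> \<bar>\<Omega> i\<bar>" for x
      using assms(18) by (auto simp: norm_mult)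
  qed
  then have eq: "\<zeta>' p = ?w p" for p
    by (rule AE_eq_imp_eq[OF A assms(10,8) \<zeta>' contw])
  \<comment> \<open>The right-hand side involves \<open>p\<close> through \<open>\<zeta> i p\<close>
    alone, \<open>?w p\<close> included, so \<open>push_cong\<close> below is mere
    substitution.\<close>
  have push: "pushforward euclidean_atlas (\<zeta> i) (v p) = (\<lambda>g. if smooth_fun euclidean_atlas g
      then frechet_derivative g (at (\<zeta> i p)) (?w p) else 0)" for p
  proof
    fix g :: "complex \<Rightarrow> real"
    have "v p (g \<circ> \<zeta> i) = frechet_derivative g (at (\<zeta> i p)) (?w p)" if g: "smooth_on UNIV g"
    proof -
      let ?D = "frechet_derivative g (at (\<zeta> i p))"
      have \<Phi>0: "\<Phi> 0 p = p" using assms(5) by (simp add: smooth_flow_def)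
      have "C_k_on (Suc 0) UNIV g" using g unfolding smooth_on_def by blast
      then have "(g has_derivative ?D) (at (\<zeta> i p))"
        by (rule C_k_on_has_derivative) simp
      moreover have "((\<lambda>t. \<zeta> i (\<Phi> t p)) has_vector_derivative ?w p) (at 0)"
        using lim[of p] \<Phi>0 eq[of p] by (intro has_vector_derivative_at_0I) simp
      \<comment> \<open>The chain rule has base point \<open>\<zeta> i (\<Phi> 0 p)\<close>;
        \<open>\<Phi>0\<close> identifies it with \<open>\<zeta> i p\<close>, where \<open>g\<close>
        is differentiated.\<close>
      ultimately have "((\<lambda>t. g (\<zeta> i (\<Phi> t p))) has_vector_derivative ?D (?w p)) (at 0)"
        using \<Phi>0 vector_derivative_diff_chain_within[of "\<lambda>t. \<zeta> i (\<Phi> t p)" "?w p" 0 UNIV g ?D]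
        by (simp add: comp_def has_derivative_at_withinI)
      then have "((\<lambda>t. ((g \<circ> \<zeta> i) (\<Phi> t p) - (g \<circ> \<zeta> i) p) / t) \<longlongrightarrow> ?D (?w p)) (at 0)"
        using \<Phi>0 by (simp add: has_real_derivative_iff_has_vector_derivative[symmetric] DERIV_def)
      \<comment> \<open>The same quotient has a second limit, since \<open>v\<close> generates the
        flow and \<open>g \<circ> \<zeta> i\<close> is smooth; uniqueness of limits equates the
        two.\<close>
      moreover have "((\<lambda>t. ((g \<circ> \<zeta> i) (\<Phi> t p) - (g \<circ> \<zeta> i) p) / t) \<longlongrightarrow> v p (g \<circ> \<zeta> i)) (at 0)"
        using gen smooth_fun_compose[OF A \<zeta> g] by (auto simp: generates_flow_def)
      ultimately show ?thesis
        using tendsto_unique[OF trivial_limit_at] by blast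
    qed
    then show "pushforward euclidean_atlas (\<zeta> i) (v p) g = (if smooth_fun euclidean_atlas g
      then frechet_derivative g (at (\<zeta> i p)) (?w p) else 0)"
      by (simp add: pushforward_def smooth_fun_euclidean_iff)
  qed
  have push_cong: "pushforward euclidean_atlas (\<zeta> i) (v a) = pushforward euclidean_atlas (\<zeta> i) (v b)"
    if "\<zeta> i a = \<zeta> i b" for a b
    unfolding push[of a] push[of b] that ..
  have "v p \<in> tangent_space A p" for p
    using gen by (simp add: generates_flow_def smooth_vector_field_def)
  then show "projectible A euclidean_atlas (\<zeta> i) v"
    unfolding projectible_def using pushforward_in_tangent_space[OF A \<zeta>]
    by (blast intro: push_cong)
qed

end
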